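(* Let $n\in\mathbb N$, $1\le p<\infty$ and $p<r\le\infty$. Then the following statements hold. (1) If $r<\infty$ and $f\in L^{p,r}(\mathbb R^n)\cap L^\infty(\mathbb R^n)$, then for every $q$ with $r<q<\infty$ we have $f\in L^q(\mathbb R^n)$, and $$\|f\|_{L^q}\le 2\cdot\big(\|f\|_{L^{p,r}}\big)^{p/q}\cdot\big(\|f\|_{L^\infty}\big)^{1-p/q}.$$ (2) If $r=\infty$ and $f\in L^{p,\infty}(\mathbb R^n)\cap L^\infty(\mathbb R^n)$, then for every $q$ with $p<q<\infty$ we have $f\in L^q(\mathbb R^n)$, and $$\|f\|_{L^q}\le \Big[2^{1-1/q}\Big(\frac{q}{q-p}\Big)^{1/q}\Big]\cdot\big(\|f\|_{L^{p,\infty}}\big)^{p/q}\cdot\big(\|f\|_{L^\infty}\big)^{1-p/q}.$$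
   Context: $\mathbb R^n$ carries Lebesgue measure $m$. For a measurable function $f$ on $\mathbb R^n$, the distribution function is $d_f(\lambda)=m(\{x\in\mathbb R^n:|f(x)|>\lambda\})$, $\lambda>0$, and the non-increasing rearrangement is $f^*(t)=\inf\{\lambda>0: d_f(\lambda)\le t\}$, $t>0$. For $1\le p<\infty$ and $1\le r\le\infty$, the Lorentz space $L^{p,r}(\mathbb R^n)$ is the set of measurable $f$ with $\|f\|_{L^{p,r}}<\infty$, where $\|f\|_{L^{p,r}}=\big(\int_0^\infty [s^{1/p}f^*(s)]^r\frac{ds}{s}\big)^{1/r}$ if $r<\infty$ and $\|f\|_{L^{p,\infty}}=\sup_{s>0}s^{1/p}f^*(s)$. $\|\cdot\|_{L^q}$ and $\|\cdot\|_{L^\infty}$ are the usual Lebesgue norms on $\mathbb R^n$. *)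

theory Defs
  imports "HOL-Analysis.Analysis" "HOL-Probability.Essential_Supremum"
begin

text \<open>
  All norms take values in \<open>[0, \<infinity>]\<close>, and exponents \<open>q, r\<close> range over \<open>ennreal\<close> so that
  the endpoint \<open>\<infinity>\<close> is an ordinary value. Functions are not identified up to null sets.
\<close>

text \<open>The power \<open>x\<^sup>a\<close> for \<open>x \<in> [0, \<infinity>]\<close>; only used with a real exponent \<open>a > 0\<close>, whence the value
  at \<open>\<infinity>\<close>.\<close>

definition enn_powr :: "ennreal \<Rightarrow> real \<Rightarrow> ennreal" where
  "enn_powr x a = (if x = \<infinity> then \<infinity> else ennreal (enn2real x powr a))"

definition distribution_fun :: "(real ^ 'n \<Rightarrow> 'b::real_normed_vector) \<Rightarrow> real \<Rightarrow> ennreal" where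
  "distribution_fun f l = emeasure lebesgue {x. norm (f x) > l}"

text \<open>The infimum of the empty set is \<open>\<infinity>\<close>.\<close>

definition rearrangement :: "(real ^ 'n \<Rightarrow> 'b::real_normed_vector) \<Rightarrow> real \<Rightarrow> ennreal" where
  "rearrangement f t = Inf (ennreal ` {l. 0 < l \<and> distribution_fun f l \<le> ennreal t})"

definition lorentz_norm :: "real \<Rightarrow> ennreal \<Rightarrow> (real ^ 'n \<Rightarrow> 'b::real_normed_vector) \<Rightarrow> ennreal" where
  "lorentz_norm p r f =
     (if r = \<infinity> then (SUP s\<in>{0<..}. ennreal (s powr (1 / p)) * rearrangement f s)
      else enn_powr
        (\<integral>\<^sup>+s\<in>{0<..}. (enn_powr (ennreal (s powr (1 / p)) * rearrangement f s) (enn2real r)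
                       / ennreal s) \<partial>lborel)
        (1 / enn2real r))"

definition lorentz_space ::
    "real \<Rightarrow> ennreal \<Rightarrow> (real ^ 'n \<Rightarrow> 'b::real_normed_vector) set" where
  "lorentz_space p r = {f. f \<in> borel_measurable lebesgue \<and> lorentz_norm p r f < \<infinity>}"

definition Lp_norm :: "ennreal \<Rightarrow> (real ^ 'n \<Rightarrow> 'b::real_normed_vector) \<Rightarrow> ennreal" where
  "Lp_norm q f =
     (if q = \<infinity> then esssup lebesgue (\<lambda>x. ennreal (norm (f x)))
      else enn_powr (\<integral>\<^sup>+x. enn_powr (ennreal (norm (f x))) (enn2real q) \<partial>lebesgue)
             (1 / enn2real q))"

definition Lp_space :: "ennreal \<Rightarrow> (real ^ 'n \<Rightarrow> 'b::real_normed_vector) set" where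
  "Lp_space q = {f. f \<in> borel_measurable lebesgue \<and> Lp_norm q f < \<infinity>}"

end

theory Submission
  imports Defs
begin

text \<open>
  Write \<open>D = distribution_fun f\<close>, \<open>N\<close> for the Lorentz norm of \<open>f\<close> and \<open>M\<close> for its essential supremum.
  Both estimates bound \<open>\<integral>\<bar>f\<bar>\<^sup>q\<close> by a constant times \<open>N\<^sup>p M\<^sup>q\<^sup>-\<^sup>p\<close>, and both start from the layer cake
  formula \<open>\<integral>\<bar>f\<bar>\<^sup>c = \<integral> c l\<^sup>c\<^sup>-\<^sup>1 D(l) dl\<close>, in which only \<open>0 < l < M\<close> contributes. The rearrangement enters
  only through the implication \<open>t < D(l) \<Longrightarrow> l \<le> f\<^sup>*(t)\<close> (\<open>le_rearrangement\<close>).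

  For \<open>r = \<infinity>\<close> this implication gives \<open>D(l) \<le> (N/l)\<^sup>p\<close>, and integrating \<open>q l\<^sup>q\<^sup>-\<^sup>1 (N/l)\<^sup>p\<close> over \<open>(0, M)\<close> gives
  the constant \<open>q/(q - p)\<close>.

  For \<open>r < \<infinity>\<close> a pointwise bound on \<open>D\<close> would give a constant that blows up as \<open>r\<close> and \<open>q\<close> both tend to
  \<open>p\<close>. Instead, since \<open>\<bar>f\<bar>\<^sup>q \<le> M\<^sup>q\<^sup>-\<^sup>r \<bar>f\<bar>\<^sup>r\<close> almost everywhere, it suffices to treat \<open>q = r\<close>. With
  \<open>a = r/p \<ge> 1\<close>, the factor \<open>(s/T)\<^sup>a\<^sup>-\<^sup>1\<close> is at least \<open>1\<close> for \<open>s \<ge> T\<close>, so for every \<open>T > 0\<close>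
  \<open>D(l) \<le> T + T\<^sup>1\<^sup>-\<^sup>a \<integral> s\<^sup>a\<^sup>-\<^sup>1 ds\<close>, the integral being over \<open>0 < s < D(l)\<close>. Inserting this in the layer
  cake formula for \<open>c = r\<close> and exchanging the order of integration turns the second term into at most
  \<open>T\<^sup>1\<^sup>-\<^sup>a \<integral> s\<^sup>a\<^sup>-\<^sup>1 f\<^sup>*(s)\<^sup>r ds = T\<^sup>1\<^sup>-\<^sup>a N\<^sup>r\<close> (\<open>nn_integral_le_lorentz_truncated\<close>). The first term is
  \<open>T M\<^sup>r\<close>, and \<open>T = (N/M)\<^sup>p\<close> makes both equal to \<open>N\<^sup>p M\<^sup>r\<^sup>-\<^sup>p\<close> if \<open>N, M > 0\<close>;
  if \<open>N = 0\<close> or \<open>M = 0\<close>, the integral vanishes. The resulting constants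
  \<open>2\<^sup>1\<^sup>/\<^sup>q\<close> and \<open>(q/(q - p))\<^sup>1\<^sup>/\<^sup>q\<close> are at most the stated ones because \<open>q > 1\<close>.
\<close>

section \<open>The layer cake formula\<close>

lemma sigma_finite_lebesgue: "sigma_finite_measure (lebesgue :: 'a::euclidean_space measure)"
proof -
  obtain A :: "'a set set" where A: "countable A" "A \<subseteq> sets lborel" "\<Union>A = space lborel"
      "\<forall>a\<in>A. emeasure lborel a \<noteq> \<infinity>"
    using lborel.sigma_finite_countable by blast
  show ?thesis
  proof
    show "\<exists>A::'a set set. countable A \<and> A \<subseteq> sets lebesgue \<and> \<Union>A = space lebesgue
        \<and> (\<forall>a\<in>A. emeasure lebesgue a \<noteq> \<infinity>)"
      using A by (intro exI[of _ A]) (auto simp: subset_iff)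
  qed
qed

lemma nn_integral_powr_Ioo:
  fixes c y :: real
  assumes "0 < c" "0 \<le> y"
  shows "(\<integral>\<^sup>+l. ennreal (c * l powr (c - 1)) * indicator {0<..<y} l \<partial>lborel) = ennreal (y powr c)"
proof -
  have "((\<lambda>l. c * l powr (c - 1)) has_integral (c * (y powr (c - 1 + 1) / (c - 1 + 1)))) {0..y}"
    using assms by (intro has_integral_mult_right has_integral_powr_from_0) auto
  then have "((\<lambda>l. c * l powr (c - 1)) has_integral (y powr c)) {0<..<y}"
    using assms by (simp add: has_integral_Icc_iff_Ioo)
  then show ?thesis
    using assms by (intro nn_integral_has_integral_lebesgue') auto
qed

lemma nn_integral_powr_layer_cake:
  fixes g :: "'a \<Rightarrow> real"
  assumes "sigma_finite_measure M" and g [measurable]: "g \<in> borel_measurable M"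
    and g0: "\<And>x. 0 \<le> g x" and c: "0 < c"
  shows "(\<integral>\<^sup>+x. ennreal (g x powr c) \<partial>M) =
    (\<integral>\<^sup>+l\<in>{0<..}. ennreal (c * l powr (c - 1)) * emeasure M {x\<in>space M. l < g x} \<partial>lborel)"
proof -
  interpret sigma_finite_measure M by fact
  interpret pair_sigma_finite M lborel ..
  let ?h = "\<lambda>x l. ennreal (c * l powr (c - 1)) * indicator {0<..<g x} l"
  have "(\<lambda>(x, l). ennreal (c * l powr (c - 1)) * (if 0 < l \<and> l < g x then 1 else 0))
      \<in> borel_measurable (M \<Otimes>\<^sub>M lborel)"
    by measurable
  then have meas: "case_prod ?h \<in> borel_measurable (M \<Otimes>\<^sub>M lborel)"
    by (simp add: indicator_def)
  have "(\<integral>\<^sup>+x. ennreal (g x powr c) \<partial>M) = (\<integral>\<^sup>+x. \<integral>\<^sup>+l. ?h x l \<partial>lborel \<partial>M)"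
    by (simp add: nn_integral_powr_Ioo c g0)
  also have "\<dots> = (\<integral>\<^sup>+l. \<integral>\<^sup>+x. ?h x l \<partial>M \<partial>lborel)"
    by (rule Fubini'[OF meas, symmetric])
  also have "\<dots> = (\<integral>\<^sup>+l\<in>{0<..}. ennreal (c * l powr (c - 1)) * emeasure M {x\<in>space M. l < g x} \<partial>lborel)"
  proof (intro nn_integral_cong)
    fix l :: real
    have "(\<integral>\<^sup>+x. ?h x l \<partial>M) = (\<integral>\<^sup>+x. (ennreal (c * l powr (c - 1)) * indicator {0<..} l)
        * indicator {x\<in>space M. l < g x} x \<partial>M)"
      by (intro nn_integral_cong) (auto simp: indicator_def)
    also have "\<dots> = (ennreal (c * l powr (c - 1)) * indicator {0<..} l) * emeasure M {x\<in>space M. l < g x}"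
      by (rule nn_integral_cmult_indicator) measurable
    finally show "(\<integral>\<^sup>+x. ?h x l \<partial>M) =
        ennreal (c * l powr (c - 1)) * emeasure M {x\<in>space M. l < g x} * indicator {0<..} l"
      by (simp add: ac_simps)
  qed
  finally show ?thesis .
qed

lemma nn_integral_norm_powr_distribution:
  fixes f :: "real ^ 'n \<Rightarrow> 'b::euclidean_space"
  assumes [measurable]: "f \<in> borel_measurable lebesgue" and "0 < c"
  shows "(\<integral>\<^sup>+x. ennreal (norm (f x) powr c) \<partial>lebesgue) =
    (\<integral>\<^sup>+l\<in>{0<..}. ennreal (c * l powr (c - 1)) * distribution_fun f l \<partial>lborel)"
  using nn_integral_powr_layer_cake[OF sigma_finite_lebesgue, of "\<lambda>x. norm (f x)" c] assms
  by (simp add: distribution_fun_def)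

section \<open>Distribution function and rearrangement\<close>

lemma antimono_distribution_fun:
  fixes f :: "real ^ 'n \<Rightarrow> 'b::euclidean_space"
  assumes [measurable]: "f \<in> borel_measurable lebesgue"
  shows "antimono (distribution_fun f)"
proof (rule antimonoI)
  fix l k :: real assume "l \<le> k"
  have "{x \<in> space lebesgue. l < norm (f x)} \<in> sets lebesgue" by measurable
  then show "distribution_fun f k \<le> distribution_fun f l"
    unfolding distribution_fun_def using \<open>l \<le> k\<close> by (intro emeasure_mono) auto
qed

lemma borel_measurable_distribution_fun [measurable]:
  fixes f :: "real ^ 'n \<Rightarrow> 'b::euclidean_space"
  assumes "f \<in> borel_measurable lebesgue"
  shows "distribution_fun f \<in> borel_measurable borel"
proof (rule borel_measurableI_greater)
  fix y :: ennreal
  \<comment> \<open>superlevel sets of an antimonotone function are intervals\<close>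
  have "is_interval {l. y < distribution_fun f l}"
    unfolding is_interval_1
    using antimono_distribution_fun[OF assms, THEN antimonoD] less_le_trans by blast
  then show "{l \<in> space borel. y < distribution_fun f l} \<in> sets borel"
    by (simp add: real_interval_borel_measurable)
qed

text \<open>
  The strict inequality \<open>l < f\<^sup>*(t)\<close> would need the right continuity of the distribution function;
  the weak one suffices, since it differs only at one value of \<open>l\<close>.
\<close>

lemma le_rearrangement:
  fixes f :: "real ^ 'n \<Rightarrow> 'b::euclidean_space"
  assumes "f \<in> borel_measurable lebesgue" and "ennreal t < distribution_fun f l"
  shows "ennreal l \<le> rearrangement f t"
  unfolding rearrangement_def
proof (rule Inf_greatest, clarify)
  fix k :: real assume "distribution_fun f k \<le> ennreal t"
  with assms antimonoD[OF antimono_distribution_fun[OF assms(1)], of k l] show "ennreal l \<le> ennreal k"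
    by (metis ennreal_leI leD le_cases order_trans)
qed

lemma distribution_fun_eq_0:
  fixes f :: "real ^ 'n \<Rightarrow> 'b::euclidean_space"
  assumes [measurable]: "f \<in> borel_measurable lebesgue" and "AE x in lebesgue. norm (f x) \<le> M" "M \<le> l"
  shows "distribution_fun f l = 0"
proof -
  have "AE x in lebesgue. \<not> (l < norm (f x))" using assms(2,3) by auto
  moreover have "{x \<in> space lebesgue. l < norm (f x)} \<in> sets lebesgue" by measurable
  ultimately have "emeasure lebesgue {x \<in> space lebesgue. l < norm (f x)} = 0"
    by (subst (asm) AE_iff_measurable[OF _ refl]) auto
  then show ?thesis by (simp add: distribution_fun_def)
qed

section \<open>Powers of extended nonnegative reals\<close>

lemma enn_powr_ennreal: "0 \<le> x \<Longrightarrow> enn_powr (ennreal x) a = ennreal (x powr a)"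
  by (simp add: enn_powr_def)

lemma enn_powr_mono:
  assumes "x \<le> y" "0 \<le> a"
  shows "enn_powr x a \<le> enn_powr y a"
proof (cases "y = \<infinity>")
  case False
  then show ?thesis using assms
    by (cases x; cases y) (auto simp: enn_powr_def top_unique intro!: ennreal_leI powr_mono2)
qed (simp add: enn_powr_def)

lemma enn_powr_mult_ennreal:
  assumes "0 < x"
  shows "enn_powr (ennreal x * y) a = ennreal (x powr a) * enn_powr y a"
  using assms
  by (cases y) (auto simp: enn_powr_def ennreal_mult_top powr_mult  simp flip: ennreal_mult ennreal_mult')

section \<open>The weak Lorentz space\<close>

lemma distribution_fun_le_weak_lorentz:
  fixes f :: "real ^ 'n \<Rightarrow> 'b::euclidean_space"
  assumes f: "f \<in> borel_measurable lebesgue" and p: "0 < p" and N: "0 \<le> N" "lorentz_norm p \<infinity> f = ennreal N"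
    and l: "0 < l"
  shows "distribution_fun f l \<le> ennreal ((N / l) powr p)"
proof (rule ccontr)
  assume "\<not> ?thesis"
  then obtain z where z: "ennreal ((N / l) powr p) < z" "z < distribution_fun f l"
    using dense by (metis not_le)
  then obtain t where t: "0 \<le> t" "z = ennreal t" by (cases z) auto
  with z have lt: "(N / l) powr p < t" by (simp add: ennreal_less_iff)
  then have t0: "0 < t" using powr_ge_zero[of "N/l" p] by linarith
  have "ennreal (t powr (1 / p) * l) \<le> ennreal (t powr (1/p)) * rearrangement f t"
    using le_rearrangement[OF f] z t l by (simp add: ennreal_mult mult_left_mono)
  also have "\<dots> \<le> lorentz_norm p \<infinity> f"
    unfolding lorentz_norm_def using t0 by (auto intro: SUP_upper)
  finally have "t powr (1 / p) * l \<le> N" using N l by (simp add: ennreal_le_iff)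
  then have "t powr (1 / p) \<le> N / l" using l by (simp add: field_simps)
  then have "(t powr (1 / p)) powr p \<le> (N / l) powr p" using p by (intro powr_mono2) auto
  with lt t0 p show False by (simp add: powr_powr)
qed

lemma nn_integral_le_weak_lorentz:
  fixes f :: "real ^ 'n \<Rightarrow> 'b::euclidean_space"
  assumes f [measurable]: "f \<in> borel_measurable lebesgue" and p: "0 < p" "p < q"
    and N: "0 \<le> N" "lorentz_norm p \<infinity> f = ennreal N"
    and M: "0 \<le> M" "AE x in lebesgue. norm (f x) \<le> M"
  shows "(\<integral>\<^sup>+x. ennreal (norm (f x) powr q) \<partial>lebesgue)
    \<le> ennreal (q / (q - p) * N powr p * M powr (q - p))"
proof -
  let ?C = "q / (q - p) * N powr p"
  have C: "0 \<le> ?C" using p by simp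
  have "(\<integral>\<^sup>+x. ennreal (norm (f x) powr q) \<partial>lebesgue)
      = (\<integral>\<^sup>+l\<in>{0<..}. ennreal (q * l powr (q - 1)) * distribution_fun f l \<partial>lborel)"
    using p by (intro nn_integral_norm_powr_distribution) auto
  also have "\<dots> \<le> (\<integral>\<^sup>+l. ennreal ?C * (ennreal ((q - p) * l powr (q - p - 1)) * indicator {0<..<M} l) \<partial>lborel)"
  proof (intro nn_integral_mono)
    fix l :: real
    consider "l \<le> 0" | "M \<le> l" "0 < l" | "0 < l" "l < M" by linarith
    then show "ennreal (q * l powr (q - 1)) * distribution_fun f l * indicator {0<..} l
        \<le> ennreal ?C * (ennreal ((q - p) * l powr (q - p - 1)) * indicator {0<..<M} l)"
    proof cases
      case 3
      have "ennreal (q * l powr (q - 1)) * distribution_fun f l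
          \<le> ennreal (q * l powr (q - 1)) * ennreal ((N / l) powr p)"
        by (intro mult_left_mono distribution_fun_le_weak_lorentz f p N 3) auto
      also have "\<dots> = ennreal (q * l powr (q - 1) * (N / l) powr p)"
        using p by (intro ennreal_mult[symmetric]) auto
      also have "q * l powr (q - 1) * (N / l) powr p = ?C * ((q - p) * l powr (q - p - 1))"
      proof -
        have "l powr (q - 1) * (N / l) powr p = N powr p * l powr (q - p - 1)"
          using 3 N(1) by (simp add: powr_divide powr_diff powr_add field_simps)
        then show ?thesis using p by (simp add: field_simps)
      qed
      also have "ennreal \<dots> = ennreal ?C * ennreal ((q - p) * l powr (q - p - 1))"
        using p by (intro ennreal_mult) auto
      finally show ?thesis using 3 by simp
    qed (auto simp: distribution_fun_eq_0[OF f M(2)])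
  qed
  also have "\<dots> = ennreal ?C * ennreal (M powr (q - p))"
    using p M by (subst nn_integral_cmult) (auto simp: nn_integral_powr_Ioo)
  also have "\<dots> = ennreal (?C * M powr (q - p))"
    using C by (intro ennreal_mult[symmetric]) auto
  finally show ?thesis .
qed

section \<open>Lorentz spaces with finite second exponent\<close>

text \<open>
  The length \<open>u\<close> of \<open>(0, u)\<close> is split at \<open>T\<close>; beyond \<open>T\<close> the integrand \<open>1\<close> is at most
  \<open>(s/T)\<^sup>a\<^sup>-\<^sup>1\<close>. Leaving the integral unevaluated covers \<open>u = \<infinity>\<close> without a case distinction.
\<close>

lemma ennreal_le_truncation_plus_power_integral:
  fixes u :: ennreal
  assumes "1 \<le> a" "0 < T"
  shows "u \<le> ennreal T + ennreal (T powr (1 - a)) *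
    (\<integral>\<^sup>+s. ennreal (s powr (a - 1)) * (if 0 < s \<and> ennreal s < u then 1 else 0) \<partial>lborel)"
proof -
  have "u \<le> emeasure lborel {s::real. 0 < s \<and> ennreal s < u}"
  proof (rule dense_le)
    fix z assume z: "z < u"
    then obtain x where x: "0 \<le> x" "z = ennreal x" by (cases z) auto
    have "{0<..<x} \<subseteq> {s::real. 0 < s \<and> ennreal s < u}"
      using z x by (auto intro!: le_less_trans[OF ennreal_leI, of _ x])
    moreover have "{s::real. 0 < s \<and> ennreal s < u} \<in> sets lborel" by measurable
    ultimately have "emeasure lborel {0<..<x} \<le> emeasure lborel {s::real. 0 < s \<and> ennreal s < u}"
      by (rule emeasure_mono)
    then show "z \<le> emeasure lborel {s::real. 0 < s \<and> ennreal s < u}" using x by simp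
  qed
  also have "\<dots> = (\<integral>\<^sup>+s. indicator {s::real. 0 < s \<and> ennreal s < u} s \<partial>lborel)"
    by (rule nn_integral_indicator[symmetric]) measurable
  also have "\<dots> \<le> (\<integral>\<^sup>+s. indicator {0<..<T} s + ennreal (T powr (1 - a)) *
      (ennreal (s powr (a - 1)) * (if 0 < s \<and> ennreal s < u then 1 else 0)) \<partial>lborel)"
  proof (intro nn_integral_mono)
    fix s :: real
    have "1 \<le> ennreal (T powr (1 - a)) * ennreal (s powr (a - 1))" if "T \<le> s"
    proof -
      have "T powr (1 - a) * T powr (a - 1) \<le> T powr (1 - a) * s powr (a - 1)"
        using that assms by (intro mult_left_mono powr_mono2) auto
      then show ?thesis using assms by (simp flip: ennreal_mult powr_add)
    qed
    then show "indicator {s::real. 0 < s \<and> ennreal s < u} s \<le> indicator {0<..<T} s + ennreal (T powr (1 - a)) *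
      (ennreal (s powr (a - 1)) * (if 0 < s \<and> ennreal s < u then 1 else 0))"
      by (cases "s < T") (auto simp: indicator_def)
  qed
  also have "\<dots> = (\<integral>\<^sup>+s. indicator {0<..<T} s \<partial>lborel) + ennreal (T powr (1 - a)) *
    (\<integral>\<^sup>+s. ennreal (s powr (a - 1)) * (if 0 < s \<and> ennreal s < u then 1 else 0) \<partial>lborel)"
    by (subst nn_integral_add) (auto simp: nn_integral_cmult)
  also have "(\<integral>\<^sup>+s. indicator {0<..<T} s \<partial>lborel) = ennreal T"
    using assms by simp
  finally show ?thesis .
qed

text \<open>
  The left-hand side integrates \<open>r l\<^sup>r\<^sup>-\<^sup>1\<close> over the \<open>l > 0\<close> whose distribution value exceeds \<open>s\<close>; by
  \<open>le_rearrangement\<close> these \<open>l\<close> lie in \<open>(0, f\<^sup>*(s)]\<close>.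
\<close>

lemma nn_integral_distribution_le_rearrangement:
  fixes f :: "real ^ 'n \<Rightarrow> 'b::euclidean_space"
  assumes f: "f \<in> borel_measurable lebesgue" and "0 < r"
  shows "(\<integral>\<^sup>+l. ennreal (r * l powr (r - 1)) * (if 0 < l \<and> ennreal s < distribution_fun f l then 1 else 0) \<partial>lborel)
    \<le> enn_powr (rearrangement f s) r"
proof (cases "rearrangement f s")
  case (real y)
  have "(\<integral>\<^sup>+l. ennreal (r * l powr (r - 1)) * (if 0 < l \<and> ennreal s < distribution_fun f l then 1 else 0) \<partial>lborel)
    \<le> (\<integral>\<^sup>+l. ennreal (r * l powr (r - 1)) * indicator {0<..<y} l \<partial>lborel)"
  proof (intro nn_integral_mono_AE)
    \<comment> \<open>only the null set \<open>{y}\<close> separates \<open>l \<le> y\<close> from \<open>l < y\<close>\<close>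
    have "AE l in lborel. l \<noteq> y" by (rule AE_lborel_singleton)
    then show "AE l in lborel. ennreal (r * l powr (r - 1)) * (if 0 < l \<and> ennreal s < distribution_fun f l then 1 else 0)
        \<le> ennreal (r * l powr (r - 1)) * indicator {0<..<y} l"
    proof eventually_elim
      case (elim l)
      then show ?case
        using le_rearrangement[OF f, of s l] real by (auto simp: indicator_def)
    qed
  qed
  then show ?thesis using real assms by (simp add: nn_integral_powr_Ioo enn_powr_ennreal)
qed (simp add: enn_powr_def)

lemma nn_integral_le_lorentz_truncated:
  fixes f :: "real ^ 'n \<Rightarrow> 'b::euclidean_space"
  assumes f [measurable]: "f \<in> borel_measurable lebesgue" and p: "0 < p" "p \<le> r"
    and M: "0 \<le> M" "AE x in lebesgue. norm (f x) \<le> M" and T: "0 < T"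
  shows "(\<integral>\<^sup>+x. ennreal (norm (f x) powr r) \<partial>lebesgue)
    \<le> ennreal (T * M powr r) + ennreal (T powr (1 - r / p)) *
      (\<integral>\<^sup>+s\<in>{0<..}. (enn_powr (ennreal (s powr (1 / p)) * rearrangement f s) r / ennreal s) \<partial>lborel)"
proof -
  define a where "a = r / p"
  have a: "1 \<le> a" using p by (simp add: a_def)
  let ?D = "distribution_fun f"
  let ?I = "\<lambda>s l. if 0 < s \<and> ennreal s < ?D l then 1 else 0 :: ennreal"
  let ?w = "\<lambda>l. ennreal (r * l powr (r - 1)) * indicator {0<..} l"
  let ?G = "\<lambda>l. \<integral>\<^sup>+s. ennreal (s powr (a - 1)) * ?I s l \<partial>lborel"
  let ?J = "\<integral>\<^sup>+s\<in>{0<..}. (enn_powr (ennreal (s powr (1 / p)) * rearrangement f s) r / ennreal s) \<partial>lborel"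
  have meas [measurable]: "(\<lambda>(s, l). ?w l * (ennreal (s powr (a - 1)) * ?I s l))
      \<in> borel_measurable (lborel \<Otimes>\<^sub>M lborel)"
    by measurable
  have G [measurable]: "?G \<in> borel_measurable lborel"
    by measurable
  have "(\<integral>\<^sup>+l. ?w l * ?G l \<partial>lborel) = (\<integral>\<^sup>+l. \<integral>\<^sup>+s. ?w l * (ennreal (s powr (a - 1)) * ?I s l) \<partial>lborel \<partial>lborel)"
    by (intro nn_integral_cong nn_integral_cmult[symmetric]) measurable
  also have "\<dots> = (\<integral>\<^sup>+s. \<integral>\<^sup>+l. ?w l * (ennreal (s powr (a - 1)) * ?I s l) \<partial>lborel \<partial>lborel)"
    by (rule lborel_pair.Fubini'[OF meas])
  also have "\<dots> \<le> ?J"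
  proof (intro nn_integral_mono)
    fix s :: real
    show "(\<integral>\<^sup>+l. ?w l * (ennreal (s powr (a - 1)) * ?I s l) \<partial>lborel)
        \<le> enn_powr (ennreal (s powr (1 / p)) * rearrangement f s) r / ennreal s * indicator {0<..} s"
    proof (cases "0 < s")
      case True
      have "(\<integral>\<^sup>+l. ?w l * (ennreal (s powr (a - 1)) * ?I s l) \<partial>lborel)
        = (\<integral>\<^sup>+l. ennreal (s powr (a - 1)) * (ennreal (r * l powr (r - 1)) * (if 0 < l \<and> ennreal s < ?D l then 1 else 0)) \<partial>lborel)"
        using True by (intro nn_integral_cong) (auto simp: ac_simps)
      also have "\<dots> = ennreal (s powr (a - 1)) * (\<integral>\<^sup>+l. (ennreal (r * l powr (r - 1)) * (if 0 < l \<and> ennreal s < ?D l then 1 else 0)) \<partial>lborel)"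
        by (rule nn_integral_cmult) measurable
      also have "\<dots> \<le> ennreal (s powr (a - 1)) * enn_powr (rearrangement f s) r"
        using p by (intro mult_left_mono nn_integral_distribution_le_rearrangement f) auto
      also have "\<dots> = ennreal ((s powr (1 / p)) powr r) / ennreal s * enn_powr (rearrangement f s) r"
        using True by (simp add: divide_ennreal powr_diff powr_powr a_def)
      also have "\<dots> = enn_powr (ennreal (s powr (1 / p)) * rearrangement f s) r / ennreal s"
        using True unfolding divide_ennreal_def
        by (subst enn_powr_mult_ennreal) (simp_all only: powr_gt_zero ac_simps)
      finally show ?thesis using True by simp
    qed simp
  qed
  finally have J: "(\<integral>\<^sup>+l. ?w l * ?G l \<partial>lborel) \<le> ?J" .
  have "(\<integral>\<^sup>+x. ennreal (norm (f x) powr r) \<partial>lebesgue)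
      = (\<integral>\<^sup>+l\<in>{0<..}. ennreal (r * l powr (r - 1)) * ?D l \<partial>lborel)"
    using p by (intro nn_integral_norm_powr_distribution) auto
  also have "\<dots> \<le> (\<integral>\<^sup>+l. ennreal T * (ennreal (r * l powr (r - 1)) * indicator {0<..<M} l)
      + ennreal (T powr (1 - a)) * (?w l * ?G l) \<partial>lborel)"
  proof (intro nn_integral_mono)
    fix l :: real
    consider "l \<le> 0" | "M \<le> l" "0 < l" | "0 < l" "l < M" by linarith
    then show "ennreal (r * l powr (r - 1)) * ?D l * indicator {0<..} l
        \<le> ennreal T * (ennreal (r * l powr (r - 1)) * indicator {0<..<M} l)
          + ennreal (T powr (1 - a)) * (?w l * ?G l)"
    proof cases
      case 3
      have "ennreal (r * l powr (r - 1)) * ?D l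
          \<le> ennreal (r * l powr (r - 1)) * (ennreal T + ennreal (T powr (1 - a)) * ?G l)"
        by (intro mult_left_mono ennreal_le_truncation_plus_power_integral a T) auto
      then show ?thesis using 3 by (simp add: distrib_left ac_simps)
    qed (auto simp: distribution_fun_eq_0[OF f M(2)])
  qed
  also have "\<dots> = ennreal T * ennreal (M powr r) + ennreal (T powr (1 - a)) * (\<integral>\<^sup>+l. ?w l * ?G l \<partial>lborel)"
    using p M by (subst nn_integral_add) (auto simp: nn_integral_cmult nn_integral_powr_Ioo)
  also have "\<dots> \<le> ennreal T * ennreal (M powr r) + ennreal (T powr (1 - a)) * ?J"
    by (intro add_left_mono mult_left_mono J) auto
  finally show ?thesis using T by (simp add: a_def ennreal_mult)
qed

lemma nn_integral_le_lorentz: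
  fixes f :: "real ^ 'n \<Rightarrow> 'b::euclidean_space"
  assumes f [measurable]: "f \<in> borel_measurable lebesgue" and p: "0 < p" "p < r" "r \<le> q"
    and N: "0 \<le> N" "lorentz_norm p (ennreal r) f = ennreal N"
    and M: "0 \<le> M" "AE x in lebesgue. norm (f x) \<le> M"
  shows "(\<integral>\<^sup>+x. ennreal (norm (f x) powr q) \<partial>lebesgue)
    \<le> ennreal (2 * N powr p * M powr (q - p))"
proof (cases "M = 0")
  case True
  then have "AE x in lebesgue. ennreal (norm (f x) powr q) = 0"
    using M(2) by (auto simp: p)
  then have "(\<integral>\<^sup>+x. ennreal (norm (f x) powr q) \<partial>lebesgue) = 0"
    by (subst nn_integral_0_iff_AE) measurable
  then show ?thesis by simp
next
  case False
  with M have M0: "0 < M" by simp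
  \<comment> \<open>\<open>J\<close> is the \<open>r\<close>-th power of the Lorentz norm\<close>
  define J where "J = (\<integral>\<^sup>+s\<in>{0<..}. (enn_powr (ennreal (s powr (1 / p)) * rearrangement f s) r / ennreal s) \<partial>lborel)"
  have "enn_powr J (1 / r) = ennreal N"
    using N p by (simp add: lorentz_norm_def J_def)
  then have J: "J = ennreal (N powr r)"
    using p N by (cases J) (auto simp: enn_powr_def powr_powr)
  have trunc: "(\<integral>\<^sup>+x. ennreal (norm (f x) powr r) \<partial>lebesgue)
      \<le> ennreal (T * M powr r + T powr (1 - r / p) * N powr r)" if "0 < T" for T
    using nn_integral_le_lorentz_truncated[OF f _ _ M that, of p r] p that
    by (simp add: J[unfolded J_def] flip: ennreal_mult ennreal_plus)
  have r: "(\<integral>\<^sup>+x. ennreal (norm (f x) powr r) \<partial>lebesgue) \<le> ennreal (2 * N powr p * M powr (r - p))"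
  proof (cases "N = 0")
    case True
    \<comment> \<open>for \<open>N = 0\<close> the truncated bound is \<open>T * M powr r\<close> with \<open>T > 0\<close> arbitrary\<close>
    have "(\<integral>\<^sup>+x. ennreal (norm (f x) powr r) \<partial>lebesgue) \<le> 0"
    proof (rule ennreal_le_epsilon)
      fix e :: real assume "0 < e"
      then show "(\<integral>\<^sup>+x. ennreal (norm (f x) powr r) \<partial>lebesgue) \<le> 0 + ennreal e"
        using trunc[of "e / M powr r"] True M0 p by simp
    qed
    then show ?thesis by simp
  next
    case False
    with N have N0: "0 < N" by simp
    \<comment> \<open>\<open>T\<close> makes the two terms of the truncated estimate equal\<close>
    define T where "T = (N / M) powr p"
    have T: "0 < T" using M0 N0 by (simp add: T_def)
    have "T * M powr r = N powr p * M powr (r - p)"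
      using M0 N0 by (simp add: T_def powr_divide powr_diff)
    moreover have "T powr (1 - r / p) * N powr r = N powr p * M powr (r - p)"
    proof -
      have "T powr (1 - r / p) = (N / M) powr (p - r)"
        using p by (simp add: T_def powr_powr algebra_simps)
      then show ?thesis using M0 N0 by (simp add: powr_divide powr_diff)
    qed
    ultimately show ?thesis using trunc[OF T] by (simp add: mult.assoc)
  qed
  have "(\<integral>\<^sup>+x. ennreal (norm (f x) powr q) \<partial>lebesgue)
      \<le> (\<integral>\<^sup>+x. ennreal (M powr (q - r)) * ennreal (norm (f x) powr r) \<partial>lebesgue)"
  proof (rule nn_integral_mono_AE)
    show "AE x in lebesgue. ennreal (norm (f x) powr q)
        \<le> ennreal (M powr (q - r)) * ennreal (norm (f x) powr r)"
      using M(2)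
    proof eventually_elim
      case (elim x)
      have "norm (f x) powr q = norm (f x) powr (q - r) * norm (f x) powr r"
        by (simp flip: powr_add)
      also have "\<dots> \<le> M powr (q - r) * norm (f x) powr r"
        using elim p by (intro mult_right_mono powr_mono2) auto
      finally show ?case by (simp add: ennreal_leI flip: ennreal_mult)
    qed
  qed
  also have "\<dots> = ennreal (M powr (q - r)) * (\<integral>\<^sup>+x. ennreal (norm (f x) powr r) \<partial>lebesgue)"
    by (rule nn_integral_cmult) measurable
  also have "\<dots> \<le> ennreal (M powr (q - r)) * ennreal (2 * N powr p * M powr (r - p))"
    by (intro mult_left_mono r) auto
  also have "\<dots> = ennreal (2 * N powr p * (M powr (q - r) * M powr (r - p)))"
    by (simp add: ac_simps flip: ennreal_mult)
  also have "M powr (q - r) * M powr (r - p) = M powr (q - p)"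
    by (simp flip: powr_add)
  finally show ?thesis .
qed

section \<open>The norm inequalities\<close>

lemma Lp_norm_le_of_nn_integral_le:
  fixes f :: "real ^ 'n \<Rightarrow> 'b::euclidean_space"
  assumes f: "f \<in> borel_measurable lebesgue" and pq: "0 < p" "p < q" and "0 \<le> C" "0 \<le> N" "0 \<le> M"
    and le: "(\<integral>\<^sup>+x. ennreal (norm (f x) powr q) \<partial>lebesgue) \<le> ennreal (C * N powr p * M powr (q - p))"
  shows "f \<in> Lp_space (ennreal q)"
    and "Lp_norm (ennreal q) f \<le> ennreal (C powr (1 / q)) * enn_powr (ennreal N) (p / q) * enn_powr (ennreal M) (1 - p / q)"
proof -
  have "Lp_norm (ennreal q) f = enn_powr (\<integral>\<^sup>+x. ennreal (norm (f x) powr q) \<partial>lebesgue) (1 / q)"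
    using pq by (simp add: Lp_norm_def enn_powr_ennreal)
  also have "\<dots> \<le> enn_powr (ennreal (C * N powr p * M powr (q - p))) (1 / q)"
    using pq by (intro enn_powr_mono le) auto
  also have "\<dots> = ennreal (C powr (1 / q) * N powr (p / q) * M powr (1 - p / q))"
    using assms by (simp add: enn_powr_ennreal powr_mult powr_powr diff_divide_distrib)
  finally have *: "Lp_norm (ennreal q) f \<le> ennreal (C powr (1 / q) * N powr (p / q) * M powr (1 - p / q))" .
  then show "f \<in> Lp_space (ennreal q)"
    using f by (auto simp: Lp_space_def less_top[symmetric] top_unique)
  show "Lp_norm (ennreal q) f \<le> ennreal (C powr (1 / q)) * enn_powr (ennreal N) (p / q) * enn_powr (ennreal M) (1 - p / q)"
    using * assms by (simp add: enn_powr_ennreal flip: ennreal_mult)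
qed

lemma Lp_space_infinity_AE_bound:
  fixes f :: "real ^ 'n \<Rightarrow> 'b::euclidean_space"
  assumes "f \<in> Lp_space \<infinity>"
  obtains M where "0 \<le> M" "Lp_norm \<infinity> f = ennreal M" "AE x in lebesgue. norm (f x) \<le> M"
proof (cases "Lp_norm \<infinity> f")
  case (real M)
  have "AE x in lebesgue. ennreal (norm (f x)) \<le> ennreal M"
    using esssup_AE[of "\<lambda>x. ennreal (norm (f x))" lebesgue] real by (simp add: Lp_norm_def)
  with real show ?thesis by (intro that[of M]) auto
qed (use assms in \<open>auto simp: Lp_space_def\<close>)

theorem theorem3p1:
  fixes p :: real and r :: ennreal
    and f :: "real ^ 'n \<Rightarrow> 'b :: {real_normed_field, euclidean_space}"
  assumes "1 \<le> p" and "ennreal p < r"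
  shows
    "(r < \<infinity> \<and> f \<in> lorentz_space p r \<inter> Lp_space \<infinity> \<longrightarrow>
       (\<forall>q::real. r < ennreal q \<longrightarrow>
          f \<in> Lp_space (ennreal q) \<and>
          Lp_norm (ennreal q) f
            \<le> 2 * enn_powr (lorentz_norm p r f) (p / q) * enn_powr (Lp_norm \<infinity> f) (1 - p / q)))
     \<and>
     (r = \<infinity> \<and> f \<in> lorentz_space p \<infinity> \<inter> Lp_space \<infinity> \<longrightarrow>
       (\<forall>q::real. p < q \<longrightarrow>
          f \<in> Lp_space (ennreal q) \<and>
          Lp_norm (ennreal q) f
            \<le> ennreal (2 powr (1 - 1 / q) * (q / (q - p)) powr (1 / q))
               * enn_powr (lorentz_norm p \<infinity> f) (p / q) * enn_powr (Lp_norm \<infinity> f) (1 - p / q)))"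
proof (intro conjI impI allI; elim conjE IntE)
  fix q :: real
  assume r: "r < \<infinity>" "r < ennreal q" and f: "f \<in> lorentz_space p r" and fM: "f \<in> Lp_space \<infinity>"
  obtain r' where r': "r = ennreal r'" "0 \<le> r'" using r by (cases r) auto
  have pr: "p < r'" "r' < q" using assms r r' by (auto simp: ennreal_less_iff)
  obtain M where M: "0 \<le> M" "Lp_norm \<infinity> f = ennreal M" "AE x in lebesgue. norm (f x) \<le> M"
    using Lp_space_infinity_AE_bound[OF fM] .
  obtain N where N: "0 \<le> N" "lorentz_norm p r f = ennreal N"
    using f by (cases "lorentz_norm p r f") (auto simp: lorentz_space_def)
  have meas: "f \<in> borel_measurable lebesgue" using f by (simp add: lorentz_space_def)
  have "(\<integral>\<^sup>+x. ennreal (norm (f x) powr q) \<partial>lebesgue) \<le> ennreal (2 * N powr p * M powr (q - p))"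
    using nn_integral_le_lorentz[OF meas _ pr(1) _ N(1) _ M(1,3), of q] assms pr N r' by simp
  note L = Lp_norm_le_of_nn_integral_le[OF meas _ _ _ N(1) M(1) this]
  show "f \<in> Lp_space (ennreal q)" using L assms pr by auto
  have "(2::real) powr (1 / q) \<le> 2 powr 1" using assms pr by (intro powr_mono) auto
  then have "ennreal (2 powr (1 / q)) \<le> 2" by (simp flip: ennreal_numeral)
  then show "Lp_norm (ennreal q) f
      \<le> 2 * enn_powr (lorentz_norm p r f) (p / q) * enn_powr (Lp_norm \<infinity> f) (1 - p / q)"
    using L(2) assms pr unfolding M N
    by (intro order_trans[OF L(2)] mult_right_mono) auto
next
  fix q :: real
  assume pq: "p < q" and f: "f \<in> lorentz_space p \<infinity>" and fM: "f \<in> Lp_space \<infinity>"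
  obtain M where M: "0 \<le> M" "Lp_norm \<infinity> f = ennreal M" "AE x in lebesgue. norm (f x) \<le> M"
    using Lp_space_infinity_AE_bound[OF fM] .
  obtain N where N: "0 \<le> N" "lorentz_norm p \<infinity> f = ennreal N"
    using f by (cases "lorentz_norm p \<infinity> f") (auto simp: lorentz_space_def)
  have meas: "f \<in> borel_measurable lebesgue" using f by (simp add: lorentz_space_def)
  have "(\<integral>\<^sup>+x. ennreal (norm (f x) powr q) \<partial>lebesgue) \<le> ennreal (q / (q - p) * N powr p * M powr (q - p))"
    using nn_integral_le_weak_lorentz[OF meas _ pq N M(1,3)] assms by simp
  note L = Lp_norm_le_of_nn_integral_le[OF meas _ pq _ N(1) M(1) this]
  show "f \<in> Lp_space (ennreal q)" using L assms pq by auto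
  have "(q / (q - p)) powr (1 / q) \<le> 2 powr (1 - 1 / q) * (q / (q - p)) powr (1 / q)"
    using assms pq by (intro mult_le_cancel_right1[THEN iffD2]) (auto intro!: ge_one_powr_ge_zero)
  then have "ennreal ((q / (q - p)) powr (1 / q)) \<le> ennreal (2 powr (1 - 1 / q) * (q / (q - p)) powr (1 / q))"
    by (rule ennreal_leI)
  then show "Lp_norm (ennreal q) f
      \<le> ennreal (2 powr (1 - 1 / q) * (q / (q - p)) powr (1 / q))
         * enn_powr (lorentz_norm p \<infinity> f) (p / q) * enn_powr (Lp_norm \<infinity> f) (1 - p / q)"
    using L(2) assms pq unfolding M N
    by (intro order_trans[OF L(2)] mult_right_mono) auto
qed

end
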